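(* The following are equivalent for a group $G$: (1) For each finite coloring of $G$, there is an infinite almost-monochromatic subgroup of $G$. (2) For each finite coloring of $G$, there is an infinite almost-monochromatic subsemigroup of $G$. (3) For each $2$-coloring of $G$, there is an infinite almost-monochromatic subgroup of $G$. (4) For each $2$-coloring of $G$, there is an infinite almost-monochromatic subsemigroup of $G$. (5) $G$ has a subgroup isomorphic to $\bigoplus_n\mathbb{Z}_2$.
   Context: A finite coloring of a set assigns one of finitely many colors to each element; a $2$-coloring uses two colors. A colored set $A$ is almost-monochromatic if all but finitely many members of $A$ have the same color. $\bigoplus_n\mathbb{Z}_2$ is the additive group of all finitely supported elements of $\mathbb{Z}_2^{\mathbb{N}}$ with pointwise addition, $\mathbb{Z}_2$ being the two-element group. *)

theory Defs
  imports "HOL-Algebra.Product_Groups" "HOL-Algebra.Elementary_Groups"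
begin

text \<open>The colors are the numbers below \<open>k\<close>; as usual, not every color has to occur.\<close>

definition coloring :: "nat \<Rightarrow> 'a set \<Rightarrow> ('a \<Rightarrow> nat) \<Rightarrow> bool" where
  "coloring k A c \<longleftrightarrow> c \<in> A \<rightarrow> {..<k}"

definition finite_coloring :: "'a set \<Rightarrow> ('a \<Rightarrow> nat) \<Rightarrow> bool" where
  "finite_coloring A c \<longleftrightarrow> (\<exists>k. coloring k A c)"

definition almost_monochromatic :: "('a \<Rightarrow> nat) \<Rightarrow> 'a set \<Rightarrow> bool" where
  "almost_monochromatic c A \<longleftrightarrow> (\<exists>i. finite {x \<in> A. c x \<noteq> i})"

definition subsemigroup :: "'a set \<Rightarrow> ('a, 'b) monoid_scheme \<Rightarrow> bool" where
  "subsemigroup S G \<longleftrightarrow>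
     S \<noteq> {} \<and> S \<subseteq> carrier G \<and> (\<forall>x\<in>S. \<forall>y\<in>S. x \<otimes>\<^bsub>G\<^esub> y \<in> S)"

definition direct_sum_Z2 :: "(nat \<Rightarrow> int) monoid" where
  "direct_sum_Z2 = sum_group UNIV (\<lambda>_. integer_mod_group 2)"

end

theory Submission
  imports Defs "HOL-Algebra.FiniteProduct"
begin

text \<open>
  A subgroup isomorphic to the direct sum is an infinite Boolean group. An idempotent nonprincipal
  ultrafilter on it contains one color class, and the Galvin--Glazer argument shows that a finite
  subgroup whose nontrivial elements lie in the starred color class can always be enlarged; a
  maximal such subgroup is therefore infinite.

  Conversely, let \<open>f\<close> send elements of infinite order to their squares and elements of finite order
  to their inverses. Away from the solutions of \<open>x\<^sup>2 = 1\<close>, all cycles of \<open>f\<close> have even length, so there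
  is a 2-coloring with \<open>c (f x) \<noteq> c x\<close>. An infinite almost-monochromatic subsemigroup for this
  coloring has only finitely many elements with \<open>x\<^sup>2 \<noteq> 1\<close>. Thus any finite Boolean subgroup \<open>H\<close> inside it
  extends by some \<open>y\<close> for which all of \<open>Hy\<close> consists of involutions, which forces \<open>y\<close> to commute
  with \<open>H\<close>.
\<close>

section \<open>Ultrafilters as minimal proper filters\<close>

text \<open>Zorn's lemma for the reversed order: a nonempty chain of proper filters is directed
  downwards, so its infimum is again proper. This is why \<open>Inf\<close> can be restricted to
  families whose infimum is not \<open>bot\<close>.\<close>

lemma minimal_filter_exists:
  fixes \<F> :: "'a filter set"
  assumes "\<F> \<noteq> {}" and nbot: "bot \<notin> \<F>"
    and Inf: "\<And>C. C \<noteq> {} \<Longrightarrow> C \<subseteq> \<F> \<Longrightarrow> Inf C \<noteq> bot \<Longrightarrow> Inf C \<in> \<F>"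
  obtains M where "M \<in> \<F>" "\<And>F. F \<in> \<F> \<Longrightarrow> F \<le> M \<Longrightarrow> F = M"
proof -
  have "\<exists>M\<in>\<F>. \<forall>F\<in>\<F>. M \<ge> F \<longrightarrow> F = M"
  proof (rule predicate_Zorn)
    show "partial_order_on \<F> (relation_of (\<ge>) \<F>)"
      by (rule partial_order_on_relation_ofI) auto
    fix C assume C: "C \<in> Chains (relation_of (\<ge>) \<F>)"
    show "\<exists>u\<in>\<F>. \<forall>a\<in>C. a \<ge> u"
    proof (cases "C = {}")
      case True
      then show ?thesis using assms(1) by auto
    next
      case False
      have sub: "C \<subseteq> \<F>" and tot: "\<And>a b. a \<in> C \<Longrightarrow> b \<in> C \<Longrightarrow> a \<le> b \<or> b \<le> a"
        using C by (auto simp: Chains_def relation_of_def)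
      have "(INF F\<in>C. F) \<noteq> bot"
      proof (subst INF_filter_bot_base)
        fix i j assume "i \<in> C" "j \<in> C"
        then show "\<exists>k\<in>C. k \<le> inf i j"
          using tot[of i j] by (metis inf.absorb1 inf.absorb2 order_refl)
      qed (use sub nbot in auto)
      then have "Inf C \<in> \<F>" using Inf[OF False sub] by simp
      then show ?thesis by (meson Inf_lower)
    qed
  qed
  then show ?thesis using that by auto
qed

text \<open>A minimal proper filter below \<open>F\<close> decides every \<open>P\<close>: if it
  does not reject \<open>P\<close>, restricting it to \<open>P\<close> leaves it proper, and
  minimality says that the restriction changed nothing.\<close>

lemma ultrafilter_exists:
  assumes "F \<noteq> bot"
  obtains U where "U \<noteq> bot" "U \<le> F"
    "\<And>P. eventually P U \<or> eventually (\<lambda>x. \<not> P x) U"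
proof -
  obtain U where U: "U \<in> {X. X \<noteq> bot \<and> X \<le> F}"
    and min: "\<And>X. X \<in> {X. X \<noteq> bot \<and> X \<le> F} \<Longrightarrow> X \<le> U \<Longrightarrow> X = U"
  proof (rule minimal_filter_exists[of "{X. X \<noteq> bot \<and> X \<le> F}"])
    fix C assume "C \<noteq> {}" "C \<subseteq> {X. X \<noteq> bot \<and> X \<le> F}" "Inf C \<noteq> bot"
    then show "Inf C \<in> {X. X \<noteq> bot \<and> X \<le> F}"
      by (auto intro: Inf_lower2)
  qed (use assms in auto)
  have "eventually P U \<or> eventually (\<lambda>x. \<not> P x) U" for P
  proof (rule disjCI)
    assume "\<not> eventually (\<lambda>x. \<not> P x) U"
    then have "inf U (principal {x. P x}) \<noteq> bot"
      by (simp add: trivial_limit_def eventually_inf_principal)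
    then have "inf U (principal {x. P x}) = U"
      using min U by (auto intro: le_infI1)
    then have "U \<le> principal {x. P x}" by (metis inf_le2)
    then show "eventually P U" by (auto simp: le_principal)
  qed
  then show ?thesis using U that by auto
qed

section \<open>Products of filters and idempotent ultrafilters\<close>

text \<open>On ultrafilters this is the product of the Stone-Cech compactification: a set A is large
  for the product iff, for \<open>E\<close>-most x, the set of y with xy in A is
  \<open>F\<close>-large.\<close>

definition filter_mult :: "('a, 'b) monoid_scheme \<Rightarrow> 'a filter \<Rightarrow> 'a filter \<Rightarrow> 'a filter" where
  "filter_mult G E F = Abs_filter (\<lambda>P. \<forall>\<^sub>F x in E. \<forall>\<^sub>F y in F. P (x \<otimes>\<^bsub>G\<^esub> y))"

lemma eventually_filter_mult:
  "eventually P (filter_mult G E F) \<longleftrightarrow> (\<forall>\<^sub>F x in E. \<forall>\<^sub>F y in F. P (x \<otimes>\<^bsub>G\<^esub> y))"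
  unfolding filter_mult_def
proof (rule eventually_Abs_filter, rule is_filter.intro)
  fix P Q :: "'a \<Rightarrow> bool"
  assume "\<forall>\<^sub>F x in E. \<forall>\<^sub>F y in F. P (x \<otimes>\<^bsub>G\<^esub> y)" "\<forall>\<^sub>F x in E. \<forall>\<^sub>F y in F. Q (x \<otimes>\<^bsub>G\<^esub> y)"
  then show "\<forall>\<^sub>F x in E. \<forall>\<^sub>F y in F. P (x \<otimes>\<^bsub>G\<^esub> y) \<and> Q (x \<otimes>\<^bsub>G\<^esub> y)"
    by (simp add: eventually_conj_iff)
next
  fix P Q :: "'a \<Rightarrow> bool"
  assume "\<forall>x. P x \<longrightarrow> Q x" "\<forall>\<^sub>F x in E. \<forall>\<^sub>F y in F. P (x \<otimes>\<^bsub>G\<^esub> y)"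
  then show "\<forall>\<^sub>F x in E. \<forall>\<^sub>F y in F. Q (x \<otimes>\<^bsub>G\<^esub> y)"
    by (auto elim!: eventually_mono)
qed simp

lemma filter_mult_mono:
  assumes "E \<le> E'" "F \<le> F'"
  shows "filter_mult G E F \<le> filter_mult G E' F'"
proof (rule filter_leI)
  fix P assume "eventually P (filter_mult G E' F')"
  then have "\<forall>\<^sub>F x in E. \<forall>\<^sub>F y in F'. P (x \<otimes>\<^bsub>G\<^esub> y)"
    using assms(1) by (auto simp: eventually_filter_mult intro: filter_leD)
  then show "eventually P (filter_mult G E F)"
    unfolding eventually_filter_mult
    by (rule eventually_mono) (use assms(2) in \<open>auto intro: filter_leD\<close>)
qed

lemma filter_mult_not_bot:
  assumes "E \<noteq> bot" "F \<noteq> bot" shows "filter_mult G E F \<noteq> bot"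
  using assms by (simp add: trivial_limit_def eventually_filter_mult)

lemma (in group) filter_mult_assoc:
  assumes "D \<le> principal (carrier G)" "E \<le> principal (carrier G)" "F \<le> principal (carrier G)"
  shows "filter_mult G (filter_mult G D E) F = filter_mult G D (filter_mult G E F)"
proof -
  have in_carrier: "eventually (\<lambda>x. x \<in> carrier G) D" "eventually (\<lambda>x. x \<in> carrier G) E"
    "eventually (\<lambda>x. x \<in> carrier G) F"
    using assms by (auto simp: le_principal)
  have "(\<forall>\<^sub>F x in D. \<forall>\<^sub>F y in E. \<forall>\<^sub>F z in F. P (x \<otimes> y \<otimes> z)) \<longleftrightarrow>
      (\<forall>\<^sub>F x in D. \<forall>\<^sub>F y in E. \<forall>\<^sub>F z in F. P (x \<otimes> (y \<otimes> z)))" for P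
  proof (rule eventually_subst, rule eventually_mono[OF in_carrier(1)],
      rule eventually_subst, rule eventually_mono[OF in_carrier(2)],
      rule eventually_subst, rule eventually_mono[OF in_carrier(3)])
  qed (simp add: m_assoc)
  then show ?thesis by (simp add: filter_eq_iff eventually_filter_mult)
qed

text \<open>The Ellis--Numakura argument for closed subsemigroups of the Stone--Cech
  compactification, with closed sets of ultrafilters replaced by filters (Papazyan).\<close>

lemma (in group) idempotent_ultrafilter_exists:
  assumes E: "E \<noteq> bot" "E \<le> principal (carrier G)" "filter_mult G E E \<le> E"
  obtains U where "U \<noteq> bot" "U \<le> E" "filter_mult G U U \<le> U"
    "\<And>P. eventually P U \<or> eventually (\<lambda>x. \<not> P x) U"
proof -
  \<comment> \<open>Members of \<open>?\<F>\<close> play the role of nonempty closed subsemigroups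
    below \<open>E\<close>; a minimal one will turn out to be a single idempotent
    ultrafilter.\<close>
  let ?\<F> = "{F. F \<noteq> bot \<and> F \<le> E \<and> filter_mult G F F \<le> F}"
  obtain F where F: "F \<in> ?\<F>" and min: "\<And>X. X \<in> ?\<F> \<Longrightarrow> X \<le> F \<Longrightarrow> X = F"
  proof (rule minimal_filter_exists[of ?\<F>])
    fix C assume C: "C \<noteq> {}" "C \<subseteq> ?\<F>" "Inf C \<noteq> bot"
    have "filter_mult G (Inf C) (Inf C) \<le> Inf C"
    proof (rule Inf_greatest)
      fix X assume "X \<in> C"
      then have "filter_mult G (Inf C) (Inf C) \<le> filter_mult G X X"
        by (intro filter_mult_mono Inf_lower)
      also have "\<dots> \<le> X" using C \<open>X \<in> C\<close> by auto
      finally show "filter_mult G (Inf C) (Inf C) \<le> X" .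
    qed
    then show "Inf C \<in> ?\<F>" using C by (auto intro: Inf_lower2)
  qed (use E in auto)
  have Fc: "F \<le> principal (carrier G)" using F E(2) by auto
  obtain p where p: "p \<noteq> bot" "p \<le> F" and ultra: "\<And>P. eventually P p \<or> eventually (\<lambda>x. \<not> P x) p"
    using ultrafilter_exists F by blast
  have pc: "p \<le> principal (carrier G)" using p Fc by auto
  have Fp_le: "filter_mult G F p \<le> F"
    using filter_mult_mono[OF order_refl p(2)] F by (blast intro: order_trans)
  \<comment> \<open>The product of \<open>F\<close> with \<open>p\<close> is again a member of
    \<open>?\<F>\<close> and lies below \<open>F\<close>, so minimality makes it all of
    \<open>F\<close>.\<close>
  have Fp: "filter_mult G F p = F"
  proof (rule min)
    let ?X = "filter_mult G F p"
    have "filter_mult G ?X ?X \<le> filter_mult G F ?X"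
      by (intro filter_mult_mono Fp_le order_refl)
    also have "\<dots> = filter_mult G (filter_mult G F F) p"
      by (simp add: filter_mult_assoc Fc pc)
    also have "\<dots> \<le> ?X" using F by (intro filter_mult_mono) auto
    finally show "?X \<in> ?\<F>" using F p Fp_le by (auto simp: filter_mult_not_bot)
  qed (rule Fp_le)
  \<comment> \<open>\<open>B A\<close> collects the x for which the left translate of A by the
    inverse of x is \<open>p\<close>-large. Hence \<open>M\<close> is the filter counterpart of the
    closed set of those q below \<open>F\<close> with qp = p.\<close>
  define B where "B A = {x. \<forall>\<^sub>F y in p. A (x \<otimes> y)}" for A
  define M where "M = (INF A\<in>{A. eventually A p}. inf F (principal (B A)))"
  have top: "(\<lambda>x. True) \<in> {A. eventually A p}" by simp
  have MF: "M \<le> F" unfolding M_def by (rule INF_lower2[OF top]) simp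
  have MB: "M \<le> principal (B A)" if "eventually A p" for A
    unfolding M_def by (rule INF_lower2[of A]) (use that in auto)
  have Mp: "filter_mult G M p \<le> p"
  proof (rule filter_leI)
    fix A assume "eventually A p"
    then show "eventually A (filter_mult G M p)"
      using MB[of A] by (simp add: eventually_filter_mult le_principal B_def)
  qed
  have "M \<noteq> bot" unfolding M_def
  proof (subst INF_filter_bot_base)
    fix A A' assume "A \<in> {A. eventually A p}" "A' \<in> {A. eventually A p}"
    then show "\<exists>k\<in>{A. eventually A p}. inf F (principal (B k))
        \<le> inf (inf F (principal (B A))) (inf F (principal (B A')))"
      by (intro bexI[of _ "\<lambda>x. A x \<and> A' x"])
        (auto simp: B_def eventually_conj_iff intro: le_infI2)
  next
    \<comment> \<open>If \<open>F\<close> avoided \<open>B A\<close>, then, \<open>p\<close> being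
      ultra, the product of \<open>F\<close> with \<open>p\<close> would avoid A. This product is
      \<open>F\<close>, and \<open>p\<close> lies below \<open>F\<close>, so \<open>p\<close> would
      contain both A and its complement.\<close>
    have "inf F (principal (B A)) \<noteq> bot" if A: "eventually A p" for A
    proof
      assume "inf F (principal (B A)) = bot"
      then have "eventually (\<lambda>x. x \<notin> B A) F"
        by (simp add: trivial_limit_def eventually_inf_principal)
      then have "\<forall>\<^sub>F x in F. \<forall>\<^sub>F y in p. \<not> A (x \<otimes> y)"
        by (rule eventually_mono) (use ultra in \<open>auto simp: B_def\<close>)
      then have "eventually (\<lambda>x. \<not> A x) F"
        by (subst Fp[symmetric]) (simp add: eventually_filter_mult)
      then have "eventually (\<lambda>x. \<not> A x) p" using p by (auto intro: filter_leD)
      with A have "eventually (\<lambda>x. False) p" by eventually_elim auto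
      then show False using p by (simp add: trivial_limit_def)
    qed
    then show "\<not> (\<exists>A\<in>{A. eventually A p}. inf F (principal (B A)) = bot)" by auto
  qed
  moreover have "filter_mult G M M \<le> M"
  proof -
    have MMF: "filter_mult G M M \<le> F"
      using filter_mult_mono[OF MF MF] F by (blast intro: order_trans)
    have "filter_mult G (filter_mult G M M) p \<le> p"
    proof -
      have "filter_mult G (filter_mult G M M) p = filter_mult G M (filter_mult G M p)"
        using MF Fc pc by (auto intro!: filter_mult_assoc)
      also have "\<dots> \<le> filter_mult G M p" by (intro filter_mult_mono Mp order_refl)
      finally show ?thesis using Mp by simp
    qed
    then have "filter_mult G M M \<le> principal (B A)" if "eventually A p" for A
      using that by (auto simp: le_principal B_def eventually_filter_mult dest: filter_leD)
    then show ?thesis using MMF unfolding M_def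
      by (auto intro!: INF_greatest)
  qed
  \<comment> \<open>\<open>M\<close> is a member of \<open>?\<F>\<close> too, so it equals
    \<open>F\<close>. Then \<open>Mp\<close> and \<open>Fp\<close> together squeeze \<open>F\<close>
    down to \<open>p\<close>.\<close>
  ultimately have "M = F" using MF F by (intro min) auto
  then have "F \<le> p" using Mp Fp by simp
  then have "F = p" using p by simp
  then show ?thesis using F ultra that by blast
qed

text \<open>The cofinite filter on the carrier is closed under the product because left translations
  are injective; every proper filter below it avoids all finite sets.\<close>

lemma (in group) nonprincipal_idempotent_ultrafilter_exists:
  assumes "infinite (carrier G)"
  obtains U where "U \<noteq> bot" "U \<le> principal (carrier G)" "U \<le> cofinite"
    "filter_mult G U U \<le> U" "\<And>P. eventually P U \<or> eventually (\<lambda>x. \<not> P x) U"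
proof -
  let ?E = "inf cofinite (principal (carrier G))"
  have ev: "eventually P ?E \<longleftrightarrow> finite {x \<in> carrier G. \<not> P x}" for P
    by (simp add: eventually_inf_principal eventually_cofinite)
  have "?E \<noteq> bot" using assms by (simp add: trivial_limit_def ev)
  moreover have "filter_mult G ?E ?E \<le> ?E"
  proof (rule filter_leI)
    fix P assume "eventually P ?E"
    then have fin: "finite {x \<in> carrier G. \<not> P x}" by (simp add: ev)
    have "finite {y \<in> carrier G. \<not> P (x \<otimes> y)}" if "x \<in> carrier G" for x
    proof (rule inj_on_finite[OF _ _ fin])
      show "inj_on (\<lambda>y. x \<otimes> y) {y \<in> carrier G. \<not> P (x \<otimes> y)}"
        using that by (auto simp: inj_on_def)
    qed (use that in auto)
    \<comment> \<open>Unfolding the product leaves a set of exceptional x that must be finite; it is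
      in fact empty.\<close>
    then have "{x \<in> carrier G. infinite {y \<in> carrier G. \<not> P (x \<otimes> y)}} = {}" by auto
    then show "eventually P (filter_mult G ?E ?E)"
      by (simp only: eventually_filter_mult ev) simp
  qed
  ultimately show ?thesis
    using idempotent_ultrafilter_exists[of ?E] that by auto
qed

section \<open>Enlarging Boolean subgroups, and Hindman's theorem\<close>

text \<open>Since h, y and hy are their own inverses, hy = inv (hy) = inv y inv h = yh. So y
  commutes with \<open>H\<close>, and \<open>H\<close> together with the coset Hy is closed under
  products.\<close>

lemma (in group) self_inverse_extension_subgroup:
  assumes H: "subgroup H G" and y: "y \<in> carrier G"
    and invH: "\<And>h. h \<in> H \<Longrightarrow> h \<otimes> h = \<one>"
    and invHy: "\<And>h. h \<in> H \<Longrightarrow> (h \<otimes> y) \<otimes> (h \<otimes> y) = \<one>"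
  shows "subgroup (H \<union> (\<lambda>h. h \<otimes> y) ` H) G"
proof -
  interpret H: subgroup H G by (rule H)
  have yy: "y \<otimes> y = \<one>" using invHy[OF H.one_closed] y by simp
  have comm: "y \<otimes> h = h \<otimes> y" if h: "h \<in> H" for h
  proof -
    have [simp]: "h \<in> carrier G" using h by auto
    have "inv (h \<otimes> y) = h \<otimes> y" using y by (intro inv_equality invHy h) auto
    moreover have "inv h = h" "inv y = y" using y by (auto intro!: inv_equality invH h yy)
    ultimately show ?thesis using y by (simp add: inv_mult_group)
  qed
  have mul: "(h \<otimes> y) \<otimes> k = (h \<otimes> k) \<otimes> y" "(h \<otimes> y) \<otimes> (k \<otimes> y) = h \<otimes> k"
    "h \<otimes> (k \<otimes> y) = (h \<otimes> k) \<otimes> y"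
    if "h \<in> H" "k \<in> H" for h k
  proof -
    have [simp]: "h \<in> carrier G" "k \<in> carrier G" using that by auto
    show "h \<otimes> (k \<otimes> y) = (h \<otimes> k) \<otimes> y" using y by (simp add: m_assoc)
    show "(h \<otimes> y) \<otimes> k = (h \<otimes> k) \<otimes> y"
      using y comm[OF that(2)] by (simp add: m_assoc)
    then have "(h \<otimes> y) \<otimes> (k \<otimes> y) = ((h \<otimes> k) \<otimes> y) \<otimes> y"
      using y by (simp add: m_assoc[symmetric])
    also have "\<dots> = h \<otimes> k" using y yy by (simp add: m_assoc)
    finally show "(h \<otimes> y) \<otimes> (k \<otimes> y) = h \<otimes> k" .
  qed
  show ?thesis
  proof (rule subgroupI)
    show "H \<union> (\<lambda>h. h \<otimes> y) ` H \<subseteq> carrier G" using y by auto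
    show "H \<union> (\<lambda>h. h \<otimes> y) ` H \<noteq> {}" using H.one_closed by blast
    show "inv a \<in> H \<union> (\<lambda>h. h \<otimes> y) ` H" if a: "a \<in> H \<union> (\<lambda>h. h \<otimes> y) ` H" for a
    proof -
      have "a \<otimes> a = \<one>" "a \<in> carrier G" using a invH invHy y by auto
      then have "inv a = a" by (intro inv_equality)
      then show ?thesis using a by simp
    qed
    show "a \<otimes> b \<in> H \<union> (\<lambda>h. h \<otimes> y) ` H"
      if "a \<in> H \<union> (\<lambda>h. h \<otimes> y) ` H" "b \<in> H \<union> (\<lambda>h. h \<otimes> y) ` H" for a b
      using that by (auto simp: mul)
  qed
qed

text \<open>A subgroup inside \<open>insert \<one> Q\<close> that is maximal by Zorn's lemma cannot
  be finite, as \<open>extend\<close> would enlarge it. The identity is adjoined because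
  \<open>Q\<close> may omit it, for instance when \<open>Q\<close> is cut out by a color. The lemma
  serves both directions of the equivalence.\<close>

lemma (in group) infinite_self_inverse_subgroup_exists:
  assumes Q: "\<And>x. x \<in> Q \<Longrightarrow> x \<otimes> x = \<one>"
    and extend: "\<And>H. subgroup H G \<Longrightarrow> finite H \<Longrightarrow> H \<subseteq> insert \<one> Q \<Longrightarrow>
      \<exists>y \<in> carrier G - H. \<forall>h\<in>H. h \<otimes> y \<in> Q"
  obtains H where "subgroup H G" "infinite H" "H \<subseteq> insert \<one> Q"
proof -
  let ?A = "{H. subgroup H G \<and> H \<subseteq> insert \<one> Q}"
  have "\<exists>M\<in>?A. \<forall>X\<in>?A. M \<subseteq> X \<longrightarrow> X = M"
  proof (rule subset_Zorn_nonempty)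
    show "?A \<noteq> {}" using triv_subgroup by blast
    fix \<C> assume C: "\<C> \<noteq> {}" "subset.chain ?A \<C>"
    have sub: "subgroup X G" "X \<subseteq> insert \<one> Q" if "X \<in> \<C>" for X
      using C that by (auto simp: subset_chain_def)
    have tot: "X \<subseteq> Y \<or> Y \<subseteq> X" if "X \<in> \<C>" "Y \<in> \<C>" for X Y
      using C that by (auto simp: subset_chain_def)
    have "subgroup (\<Union>\<C>) G"
    proof (rule subgroupI)
      show "\<Union>\<C> \<subseteq> carrier G" using sub subgroup.subset by blast
      show "\<Union>\<C> \<noteq> {}" using C sub subgroup.one_closed by fastforce
      show "inv a \<in> \<Union>\<C>" if "a \<in> \<Union>\<C>" for a
        using that sub subgroup.m_inv_closed by fastforce
      show "a \<otimes> b \<in> \<Union>\<C>" if ab: "a \<in> \<Union>\<C>" "b \<in> \<Union>\<C>" for a b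
      proof -
        obtain X where "X \<in> \<C>" "a \<in> X" "b \<in> X" using ab tot by (metis UnionE subsetD)
        then show ?thesis using subgroup.m_closed[OF sub(1)[OF \<open>X \<in> \<C>\<close>]] by blast
      qed
    qed
    then show "\<Union>\<C> \<in> ?A" using sub by blast
  qed
  then obtain M where "M \<in> ?A" and max: "\<forall>X\<in>?A. M \<subseteq> X \<longrightarrow> X = M" ..
  then have M: "subgroup M G" "M \<subseteq> insert \<one> Q" by auto
  have "infinite M"
  proof
    assume "finite M"
    then obtain y where y: "y \<in> carrier G" "y \<notin> M" "\<And>h. h \<in> M \<Longrightarrow> h \<otimes> y \<in> Q"
      using extend M by blast
    let ?X = "M \<union> (\<lambda>h. h \<otimes> y) ` M"
    have "subgroup ?X G"
    proof (rule self_inverse_extension_subgroup[OF M(1) y(1)])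
      show "h \<otimes> h = \<one>" if "h \<in> M" for h using that M Q by auto
    qed (use y Q in auto)
    moreover have "?X \<subseteq> insert \<one> Q" using M y by auto
    ultimately have "?X \<in> ?A" by simp
    with max have "M \<subseteq> ?X \<longrightarrow> ?X = M" by (rule bspec)
    then have "?X = M" by simp
    moreover have "y \<in> ?X"
      using subgroup.one_closed[OF M(1)] y(1) by (force intro: image_eqI[of _ _ \<one>])
    ultimately show False using y by blast
  qed
  then show ?thesis using M that by blast
qed

text \<open>Hindman's theorem for Boolean groups, by the Galvin--Glazer argument.\<close>

lemma (in group) monochromatic_subgroup_exists:
  assumes inf: "infinite (carrier G)" and self_inv: "\<And>x. x \<in> carrier G \<Longrightarrow> x \<otimes> x = \<one>"
    and c: "finite_coloring (carrier G) c"
  obtains H i where "subgroup H G" "infinite H" "\<And>x. x \<in> H - {\<one>} \<Longrightarrow> c x = i"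
proof -
  obtain U where U: "U \<noteq> bot" "U \<le> principal (carrier G)" "U \<le> cofinite"
    and idem: "filter_mult G U U \<le> U"
    and ultra: "\<And>P. eventually P U \<or> eventually (\<lambda>x. \<not> P x) U"
    using nonprincipal_idempotent_ultrafilter_exists[OF inf] by blast
  have carr: "\<forall>\<^sub>F x in U. x \<in> carrier G" using U(2) by (simp add: le_principal)
  obtain k where k: "\<And>x. x \<in> carrier G \<Longrightarrow> c x < k"
    using c by (auto simp: finite_coloring_def coloring_def)
  \<comment> \<open>If the ultrafilter rejected each of the finitely many color classes, it would
    reject the whole carrier.\<close>
  have "\<exists>i<k. \<forall>\<^sub>F x in U. c x = i"
  proof (rule ccontr)
    assume "\<not> (\<exists>i<k. \<forall>\<^sub>F x in U. c x = i)"
    then have "\<forall>i\<in>{..<k}. \<forall>\<^sub>F x in U. c x \<noteq> i" using ultra by (metis lessThan_iff)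
    then have "\<forall>\<^sub>F x in U. \<forall>i\<in>{..<k}. c x \<noteq> i" by (simp add: eventually_ball_finite)
    with carr have "\<forall>\<^sub>F x in U. False" by eventually_elim (use k in blast)
    then show False using U by (simp add: trivial_limit_def)
  qed
  then obtain i where i: "\<forall>\<^sub>F x in U. c x = i" by blast
  \<comment> \<open>The starred color class: the members x of the class C of color \<open>i\<close>
    for which the translate of C by the inverse of x is still \<open>U\<close>-large.\<close>
  define Q where "Q = {x \<in> carrier G. c x = i \<and> (\<forall>\<^sub>F y in U. c (x \<otimes> y) = i)}"
  have step: "\<forall>\<^sub>F y in U. \<forall>\<^sub>F z in U. P (y \<otimes> z)" if "eventually P U" for P
    using filter_leD[OF idem that] by (simp add: eventually_filter_mult)
  have Q1: "\<forall>\<^sub>F y in U. y \<in> Q"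
    using i carr step[OF i] by eventually_elim (simp add: Q_def)
  \<comment> \<open>The point of starring: translating by x in \<open>Q\<close> keeps
    \<open>U\<close>-most elements in \<open>Q\<close> itself, not only in the color class.
    Idempotency, in the form \<open>step\<close>, supplies the second layer of largeness.\<close>
  have Qx: "\<forall>\<^sub>F y in U. x \<otimes> y \<in> Q" if x: "x \<in> Q" for x
  proof -
    have xc: "x \<in> carrier G" and ev: "\<forall>\<^sub>F y in U. c (x \<otimes> y) = i" using x by (auto simp: Q_def)
    show ?thesis using ev carr step[OF ev]
    proof eventually_elim
      case (elim y)
      have "\<forall>\<^sub>F z in U. c (x \<otimes> y \<otimes> z) = i"
        using carr elim(3) by eventually_elim (use xc elim in \<open>simp add: m_assoc\<close>)
      then show ?case using xc elim by (simp add: Q_def)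
    qed
  qed
  obtain H where H: "subgroup H G" "infinite H" "H \<subseteq> insert \<one> Q"
  proof (rule infinite_self_inverse_subgroup_exists[of Q])
    show "x \<otimes> x = \<one>" if "x \<in> Q" for x using that self_inv by (simp add: Q_def)
    fix H assume H: "subgroup H G" "finite H" "H \<subseteq> insert \<one> Q"
    \<comment> \<open>Each h in the finite \<open>H\<close> imposes one \<open>U\<close>-large
      condition on y, with \<open>Q1\<close> covering the identity. Their intersection is large, and
      nonprincipality lets y avoid \<open>H\<close>.\<close>
    have "\<forall>\<^sub>F y in U. h \<otimes> y \<in> Q" if h: "h \<in> H" for h
    proof (cases "h = \<one>")
      case True
      show ?thesis using Q1 by eventually_elim (simp add: True Q_def)
    next
      case False
      then show ?thesis using Qx h H by auto
    qed
    then have "\<forall>\<^sub>F y in U. \<forall>h\<in>H. h \<otimes> y \<in> Q" using H by (simp add: eventually_ball_finite)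
    moreover have "\<forall>\<^sub>F y in U. y \<notin> H"
      using U(3) H by (intro filter_leD[OF U(3)]) (simp add: eventually_cofinite)
    ultimately have "\<forall>\<^sub>F y in U. y \<in> carrier G - H \<and> (\<forall>h\<in>H. h \<otimes> y \<in> Q)"
      using carr by eventually_elim auto
    then show "\<exists>y\<in>carrier G - H. \<forall>h\<in>H. h \<otimes> y \<in> Q"
      using eventually_happens'[OF U(1)] by blast
  qed
  show ?thesis by (rule that[OF H(1,2), of i]) (use H(3) in \<open>auto simp: Q_def\<close>)
qed

section \<open>A 2-coloring that forces involutions\<close>

text \<open>The graph joining x to \<open>f x\<close> has only even cycles on \<open>A\<close>, so
  it is bipartite there: color each point by the parity of its distance to a chosen root of its
  component.\<close>

lemma alternating_coloring_exists:
  fixes f :: "'a \<Rightarrow> 'a"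
  assumes closed: "\<And>x. x \<in> A \<Longrightarrow> f x \<in> A"
    and even_period: "\<And>x n. x \<in> A \<Longrightarrow> (f ^^ n) x = x \<Longrightarrow> even n"
  obtains c :: "'a \<Rightarrow> nat" where "\<And>x. c x < 2" "\<And>x. x \<in> A \<Longrightarrow> c (f x) \<noteq> c x"
proof -
  \<comment> \<open>\<open>meet\<close> says that forward orbits merge, so its classes are the
    components; \<open>r x\<close> is the root, and i + j is the length of a walk from x to
    it.\<close>
  define meet where "meet x y \<longleftrightarrow> (\<exists>i j. (f ^^ i) x = (f ^^ j) y)" for x y
  define r where "r x = (SOME y. meet x y)" for x
  define c :: "'a \<Rightarrow> nat"
    where "c x = (if \<exists>i j. (f ^^ i) x = (f ^^ j) (r x) \<and> even (i + j) then 0 else 1)" for x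
  have "meet x x" for x unfolding meet_def by blast
  then have meet_r: "meet x (r x)" for x unfolding r_def by (rule someI)
  \<comment> \<open>Equality of the two predicates makes the choice operator in \<open>r\<close>
    return the same root for x and \<open>f x\<close>.\<close>
  have "meet (f x) = meet x" for x
  proof (rule ext, rule iffI)
    fix y
    show "meet x y" if m: "meet (f x) y"
    proof -
      obtain i j where "(f ^^ i) (f x) = (f ^^ j) y" using m by (auto simp: meet_def)
      then have "(f ^^ Suc i) x = (f ^^ j) y" by (simp add: funpow_swap1)
      then show ?thesis unfolding meet_def by blast
    qed
    show "meet (f x) y" if m: "meet x y"
    proof -
      obtain i j where "(f ^^ i) x = (f ^^ j) y" using m by (auto simp: meet_def)
      then have "(f ^^ i) (f x) = (f ^^ Suc j) y" by (simp add: funpow_swap1[symmetric])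
      then show ?thesis unfolding meet_def by blast
    qed
  qed
  then have r_f: "r (f x) = r x" for x by (simp add: r_def)
  have orbit: "(f ^^ n) x \<in> A" if "x \<in> A" for x n
    using that by (induction n) (auto intro: closed)
  have even_diff: "even (b - a)" if "(f ^^ a) z = (f ^^ b) z" "(f ^^ a) z \<in> A" "a \<le> b" for a b z
  proof -
    have "(f ^^ (b - a)) ((f ^^ a) z) = (f ^^ b) z"
      using that(3) by (metis comp_apply funpow_add le_add_diff_inverse2)
    then show ?thesis using even_period that by metis
  qed
  \<comment> \<open>Applying f i' times to the first merging and i times to the second brings both
    to the same point. The two iterates of z then coincide in \<open>A\<close>, so their exponents
    differ by a period, which is even.\<close>
  have parity: "even (i + j) \<longleftrightarrow> even (i' + j')"
    if x: "x \<in> A" and e: "(f ^^ i) x = (f ^^ j) z" "(f ^^ i') x = (f ^^ j') z" for x z i j i' j'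
  proof -
    have 1: "(f ^^ (j + i')) z = (f ^^ (i + i')) x"
      using e(1) by (simp add: funpow_add add.commute[of j] add.commute[of i])
    have 2: "(f ^^ (j' + i)) z = (f ^^ (i + i')) x"
      using e(2) by (simp add: funpow_add add.commute[of j'])
    have "even (j' + i - (j + i'))" if "j + i' \<le> j' + i"
      using even_diff[OF _ _ that, of z] 1 2 orbit[OF x] by simp
    moreover have "even (j + i' - (j' + i))" if "j' + i \<le> j + i'"
      using even_diff[OF _ _ that, of z] 1 2 orbit[OF x] by simp
    ultimately show ?thesis by presburger
  qed
  have "c (f x) \<noteq> c x" if x: "x \<in> A" for x
  proof -
    obtain i j where ij: "(f ^^ i) x = (f ^^ j) (r x)" using meet_r[of x] by (auto simp: meet_def)
    \<comment> \<open>One further step on both sides: from \<open>f x\<close> the same i works, with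
      j + 1 steps from the root, which flips the parity.\<close>
    then have ij': "(f ^^ i) (f x) = (f ^^ Suc j) (r (f x))"
      by (simp add: funpow_swap1[symmetric] r_f)
    have "(\<exists>i j. (f ^^ i) x = (f ^^ j) (r x) \<and> even (i + j)) \<longleftrightarrow> even (i + j)"
      using ij parity[OF x _ ij] by blast
    then have "c x = 0 \<longleftrightarrow> even (i + j)" by (simp add: c_def)
    moreover have "(\<exists>i j. (f ^^ i) (f x) = (f ^^ j) (r (f x)) \<and> even (i + j)) \<longleftrightarrow> even (i + Suc j)"
      using ij' parity[OF closed[OF x] _ ij'] by blast
    then have "c (f x) = 0 \<longleftrightarrow> even (i + Suc j)" by (simp add: c_def)
    ultimately show ?thesis by auto
  qed
  then show ?thesis by (intro that[of c]) (auto simp: c_def)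
qed

lemma subsemigroup_nat_pow_closed:
  assumes "monoid G" "subsemigroup S G" "x \<in> S"
  shows "x [^]\<^bsub>G\<^esub> Suc n \<in> S"
proof -
  interpret monoid G by fact
  show ?thesis
    using assms(2,3) by (induction n) (auto simp: subsemigroup_def)
qed

lemma (in group) coloring_forcing_involutions:
  obtains c where "coloring 2 (carrier G) c"
    "\<And>S. subsemigroup S G \<Longrightarrow> almost_monochromatic c S \<Longrightarrow> finite {x \<in> S. x \<otimes> x \<noteq> \<one>}"
proof -
  define tor where "tor x \<longleftrightarrow> (\<exists>n>0. x [^] (n::nat) = \<one>)" for x
  \<comment> \<open>Inversion gives 2-cycles off the solutions of x x = 1. Squaring has no cycle on
    elements of infinite order, since its iterates are the distinct powers with exponents
    2^n.\<close>
  define f where "f x = (if tor x then inv x else x \<otimes> x)" for x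
  define A where "A = {x \<in> carrier G. x \<otimes> x \<noteq> \<one>}"
  have pow_inj: "m = n" if "x \<in> carrier G" "\<not> tor x" "x [^] m = x [^] n" for x and m n :: nat
  proof -
    have *: "\<not> m < n" if "x [^] m = x [^] n" for m n :: nat
    proof
      assume "m < n"
      have "x [^] m \<otimes> x [^] (n - m) = x [^] m"
        using nat_pow_mult[OF \<open>x \<in> carrier G\<close>, of m "n - m"] \<open>m < n\<close> that by simp
      then have "x [^] (n - m) = \<one>" using \<open>x \<in> carrier G\<close> by simp
      then show False using \<open>m < n\<close> \<open>\<not> tor x\<close> unfolding tor_def by (meson zero_less_diff)
    qed
    show ?thesis using *[of m n] *[of n m] that by force
  qed
  have sq: "x \<otimes> x = x [^] (2::nat)" if "x \<in> carrier G" for x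
    using that by (simp add: numeral_2_eq_2)
  have tor_pow: "tor x" if "x \<in> carrier G" "tor (x [^] m)" "m > 0" for x and m :: nat
    using that unfolding tor_def by (metis nat_0_less_mult_iff nat_pow_pow)
  have tor_inv: "tor (inv x)" if "x \<in> carrier G" "tor x" for x
    using that unfolding tor_def by (metis inv_one nat_pow_inv)
  have f_pow: "(f ^^ n) x = x [^] ((2::nat) ^ n)" if "x \<in> carrier G" "\<not> tor x" for x n
  proof (induction n)
    case (Suc n)
    have "\<not> tor (x [^] ((2::nat) ^ n))" using that tor_pow by (metis zero_less_numeral zero_less_power)
    then have "f (x [^] ((2::nat) ^ n)) = x [^] ((2::nat) ^ n) \<otimes> x [^] ((2::nat) ^ n)"
      by (simp add: f_def)
    then have "(f ^^ Suc n) x = x [^] ((2::nat) ^ n) \<otimes> x [^] ((2::nat) ^ n)"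
      using Suc by simp
    then show ?case using that by (simp add: nat_pow_mult mult_2)
  qed (use that in simp)
  have f_inv: "(f ^^ n) x = (if even n then x else inv x)" if "x \<in> carrier G" "tor x" for x n
    using that tor_inv by (induction n) (auto simp: f_def)
  have not_tor_A: "x \<in> A" if "x \<in> carrier G" "\<not> tor x" for x
  proof -
    have "x [^] (2::nat) \<noteq> \<one>" using that(2) unfolding tor_def by (metis zero_less_numeral)
    then show ?thesis using that sq by (simp add: A_def)
  qed
  obtain c :: "'a \<Rightarrow> nat" where c2: "\<And>x. c x < 2" and c_alt: "\<And>x. x \<in> A \<Longrightarrow> c (f x) \<noteq> c x"
  proof (rule alternating_coloring_exists[of A f])
    show "f x \<in> A" if x: "x \<in> A" for x
    proof (cases "tor x")
      case True
      have "inv x \<otimes> inv x = inv (x \<otimes> x)" using x by (simp add: A_def inv_mult_group)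
      then show ?thesis using x True by (simp add: f_def A_def)
    next
      case False
      then have "\<not> tor (x \<otimes> x)" using x sq tor_pow[of x 2] by (auto simp: A_def)
      then have "x \<otimes> x \<in> A" using x by (intro not_tor_A) (auto simp: A_def)
      then show ?thesis using False by (simp add: f_def)
    qed
    show "even n" if x: "x \<in> A" and per: "(f ^^ n) x = x" for x n
    proof (cases "tor x")
      case True
      have "inv x \<noteq> x" using x by (metis (mono_tags, lifting) A_def l_inv mem_Collect_eq)
      then show ?thesis using per f_inv[of x n] True x by (auto simp: A_def split: if_splits)
    next
      case False
      then have "x [^] ((2::nat) ^ n) = x [^] (1::nat)"
        using x per f_pow[of x n] by (simp add: A_def)
      \<comment> \<open>Only n = 0 remains, which is even.\<close>
      then have "(2::nat) ^ n = 1" using pow_inj x False unfolding A_def by blast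
      then show ?thesis by (cases n) auto
    qed
  qed (rule that)
  have "finite {x \<in> S. x \<otimes> x \<noteq> \<one>}"
    if S: "subsemigroup S G" and am: "almost_monochromatic c S" for S
  proof -
    have Sc: "x \<in> carrier G" if "x \<in> S" for x using S that by (auto simp: subsemigroup_def)
    obtain i where fin: "finite {x \<in> S. c x \<noteq> i}" using am by (auto simp: almost_monochromatic_def)
    have pow_S: "x [^] n \<in> S" if "x \<in> S" "n > 0" for x and n :: nat
      using subsemigroup_nat_pow_closed[OF is_monoid S that(1), of "n - 1"] that by simp
    have all_tor: "tor x" if x: "x \<in> S" for x
    proof (rule ccontr)
      assume nt: "\<not> tor x"
      let ?g = "\<lambda>n. x [^] ((2::nat) ^ n)"
      \<comment> \<open>Consecutive repeated squares have different colors, so one of any two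
        differs from \<open>i\<close>. The powers are distinct, so an element of infinite order
        would give infinitely many exceptions.\<close>
      have "\<exists>n\<ge>m. n \<in> {n. c (?g n) \<noteq> i}" for m
      proof -
        have gA: "?g m \<in> A"
          using nt Sc[OF x] by (intro not_tor_A) (auto dest: tor_pow)
        have "?g (Suc m) = f (?g m)"
          using f_pow[OF Sc[OF x] nt, of m] f_pow[OF Sc[OF x] nt, of "Suc m"] by simp
        then have "c (?g (Suc m)) \<noteq> c (?g m)" using c_alt[OF gA] by simp
        then have "c (?g m) \<noteq> i \<or> c (?g (Suc m)) \<noteq> i" by auto
        then show ?thesis using le_Suc_eq by blast
      qed
      then have "infinite {n. c (?g n) \<noteq> i}" by (simp add: infinite_nat_iff_unbounded_le)
      moreover have "finite {n. c (?g n) \<noteq> i}"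
      proof (rule inj_on_finite[OF _ _ fin])
        show "inj_on ?g {n. c (?g n) \<noteq> i}"
        proof (rule inj_onI)
          fix m n assume "?g m = ?g n"
          then have "(2::nat) ^ m = 2 ^ n" by (rule pow_inj[OF Sc[OF x] nt])
          then show "m = n" by simp
        qed
      qed (use x pow_S in auto)
      ultimately show False by simp
    qed
    have inv_S: "inv x \<in> S" if x: "x \<in> S" for x
    proof -
      obtain n :: nat where n: "n > 0" "x [^] n = \<one>" using all_tor[OF x] by (auto simp: tor_def)
      \<comment> \<open>The exponent 2n - 1 is positive even for n = 1, whereas n - 1 could be 0 and
        the identity is not yet known to lie in \<open>S\<close>.\<close>
      have "x [^] (2 * n - 1) \<otimes> x = x [^] (Suc (2 * n - 1))" by simp
      also have "Suc (2 * n - 1) = n + n" using n by simp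
      also have "x [^] (n + n) = \<one>" using n Sc[OF x] by (simp add: nat_pow_mult[symmetric])
      finally have "inv x = x [^] (2 * n - 1)" using Sc[OF x] by (intro inv_equality) auto
      then show ?thesis using pow_S[OF x, of "2 * n - 1"] n by simp
    qed
    \<comment> \<open>A non-involution and its inverse have different colors and both lie in
      \<open>S\<close>, so one of them is among the finitely many exceptions.\<close>
    have "{x \<in> S. x \<otimes> x \<noteq> \<one>} \<subseteq> {x \<in> S. c x \<noteq> i} \<union> m_inv G ` {x \<in> S. c x \<noteq> i}"
    proof
      fix x assume x: "x \<in> {x \<in> S. x \<otimes> x \<noteq> \<one>}"
      then have "c (inv x) \<noteq> c x"
        using c_alt[of x] all_tor Sc by (auto simp: A_def f_def)
      then have "c x \<noteq> i \<or> c (inv x) \<noteq> i" by auto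
      moreover have "x = inv (inv x)" using x Sc by simp
      ultimately show "x \<in> {x \<in> S. c x \<noteq> i} \<union> m_inv G ` {x \<in> S. c x \<noteq> i}"
        using x inv_S by blast
    qed
    then show ?thesis using fin by (meson finite_UnI finite_imageI finite_subset)
  qed
  then show ?thesis using c2 by (intro that[of c]) (auto simp: coloring_def)
qed

text \<open>For h in a finite \<open>H\<close>, translation by h is injective, so only finitely many
  y in \<open>S\<close> make hy a non-involution. As \<open>S\<close> is infinite, some y outside
  \<open>H\<close> works for every h at once.\<close>

lemma (in group) self_inverse_subgroup_in_subsemigroup:
  assumes S: "subsemigroup S G" "infinite S" and fin: "finite {x \<in> S. x \<otimes> x \<noteq> \<one>}"
  obtains H where "subgroup H G" "infinite H" "\<And>x. x \<in> H \<Longrightarrow> x \<otimes> x = \<one>"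
proof -
  define Q where "Q = {x \<in> S. x \<otimes> x = \<one>}"
  have Sc: "x \<in> carrier G" if "x \<in> S" for x using S that by (auto simp: subsemigroup_def)
  have Sm: "x \<otimes> y \<in> S" if "x \<in> S" "y \<in> S" for x y using S that by (auto simp: subsemigroup_def)
  \<comment> \<open>A single such x puts its square, the identity, into \<open>S\<close>.\<close>
  have "\<exists>x\<in>S. x \<otimes> x = \<one>"
  proof (rule ccontr)
    assume "\<not> ?thesis"
    then have "{x \<in> S. x \<otimes> x \<noteq> \<one>} = S" by auto
    then show False using fin S by simp
  qed
  then have oneS: "\<one> \<in> S" using Sm by metis
  obtain H where H: "subgroup H G" "infinite H" "H \<subseteq> insert \<one> Q"
  proof (rule infinite_self_inverse_subgroup_exists[of Q])
    show "x \<otimes> x = \<one>" if "x \<in> Q" for x using that by (simp add: Q_def)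
    fix H assume H: "subgroup H G" "finite H" "H \<subseteq> insert \<one> Q"
    have HS: "h \<in> S" if "h \<in> H" for h using that H oneS by (auto simp: Q_def)
    have "finite {y \<in> S. h \<otimes> y \<notin> Q}" if h: "h \<in> H" for h
    proof (rule inj_on_finite[OF _ _ fin])
      show "inj_on (\<lambda>y. h \<otimes> y) {y \<in> S. h \<otimes> y \<notin> Q}"
        using Sc HS[OF h] by (auto simp: inj_on_def)
    qed (use HS[OF h] Sm in \<open>auto simp: Q_def\<close>)
    then have "finite (H \<union> (\<Union>h\<in>H. {y \<in> S. h \<otimes> y \<notin> Q}))" using H by simp
    then have "\<not> S \<subseteq> H \<union> (\<Union>h\<in>H. {y \<in> S. h \<otimes> y \<notin> Q})" using S finite_subset by blast
    then obtain y where "y \<in> S" "y \<notin> H \<union> (\<Union>h\<in>H. {y \<in> S. h \<otimes> y \<notin> Q})" by blast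
    then show "\<exists>y\<in>carrier G - H. \<forall>h\<in>H. h \<otimes> y \<in> Q" using Sc by (intro bexI[of _ y]) auto
  qed
  show ?thesis by (rule that[OF H(1,2)]) (use H(3) in \<open>auto simp: Q_def\<close>)
qed

section \<open>The direct sum inside an infinite Boolean group\<close>

lemma carrier_direct_sum_Z2:
  "carrier direct_sum_Z2 = {x. (\<forall>n. x n \<in> {0..<2}) \<and> finite {n. x n \<noteq> 0}}"
  by (auto simp: direct_sum_Z2_def carrier_sum_group carrier_integer_mod_group)

lemma mult_direct_sum_Z2: "x \<otimes>\<^bsub>direct_sum_Z2\<^esub> y = (\<lambda>n. (x n + y n) mod 2)"
  by (simp add: direct_sum_Z2_def restrict_UNIV)

lemma one_direct_sum_Z2: "\<one>\<^bsub>direct_sum_Z2\<^esub> = (\<lambda>n. 0)"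
  by (simp add: direct_sum_Z2_def restrict_UNIV)

lemma group_direct_sum_Z2: "group direct_sum_Z2"
  by (simp add: direct_sum_Z2_def)

lemma direct_sum_Z2_self_inverse: "x \<otimes>\<^bsub>direct_sum_Z2\<^esub> x = \<one>\<^bsub>direct_sum_Z2\<^esub>"
  by (auto simp: mult_direct_sum_Z2 one_direct_sum_Z2)

lemma infinite_carrier_direct_sum_Z2: "infinite (carrier direct_sum_Z2)"
proof
  assume "finite (carrier direct_sum_Z2)"
  moreover have "(\<lambda>n m. if m = n then 1 else 0) ` (UNIV :: nat set) \<subseteq> carrier direct_sum_Z2"
    by (auto simp: carrier_direct_sum_Z2)
  moreover have "inj (\<lambda>(n::nat) m. if m = n then 1 else (0::int))"
    by (rule injI) (metis zero_neq_one)
  ultimately have "finite (UNIV :: nat set)" using inj_on_finite by blast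
  then show False by simp
qed

lemma (in group) comm_group_if_self_inverse:
  assumes self_inv: "\<And>x. x \<in> carrier G \<Longrightarrow> x \<otimes> x = \<one>"
  shows "comm_group G"
proof (rule group_comm_groupI)
  have inv: "inv x = x" if "x \<in> carrier G" for x using that self_inv by (intro inv_equality)
  show "x \<otimes> y = y \<otimes> x" if "x \<in> carrier G" "y \<in> carrier G" for x y
    using inv_mult_group[OF that] that by (simp add: inv)
qed

text \<open>Factors with index in both sets occur twice and cancel. Symmetric difference thus
  mirrors addition of supports over the two-element field.\<close>

lemma (in comm_group) finprod_mult_sym_diff:
  assumes self_inv: "\<And>x. x \<in> carrier G \<Longrightarrow> x \<otimes> x = \<one>"
    and a: "\<And>n. a n \<in> carrier G" and fin: "finite I" "finite J"
  shows "finprod G a I \<otimes> finprod G a J = finprod G a ((I - J) \<union> (J - I))"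
proof -
  have split: "finprod G a X = finprod G a (X - Y) \<otimes> finprod G a (X \<inter> Y)" if "finite X" for X Y
  proof -
    have "finprod G a ((X - Y) \<union> (X \<inter> Y)) = finprod G a (X - Y) \<otimes> finprod G a (X \<inter> Y)"
      using that a by (intro finprod_Un_disjoint) auto
    moreover have "(X - Y) \<union> (X \<inter> Y) = X" by auto
    ultimately show ?thesis by simp
  qed
  let ?x = "finprod G a (I - J)" and ?y = "finprod G a (J - I)" and ?z = "finprod G a (I \<inter> J)"
  have c: "?x \<in> carrier G" "?y \<in> carrier G" "?z \<in> carrier G" using a by auto
  have "finprod G a I \<otimes> finprod G a J = (?x \<otimes> ?z) \<otimes> (?y \<otimes> ?z)"
    using split[OF fin(1), of J] split[OF fin(2), of I] by (simp add: Int_commute)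
  also have "\<dots> = (?x \<otimes> ?y) \<otimes> (?z \<otimes> ?z)" using c by (simp add: m_ac)
  also have "\<dots> = ?x \<otimes> ?y" using c self_inv by simp
  also have "\<dots> = finprod G a ((I - J) \<union> (J - I))"
    using fin a by (intro finprod_Un_disjoint[symmetric]) auto
  finally show ?thesis .
qed

text \<open>Greedy choice: the products over subsets of the earlier terms form a finite set, so the
  infinite carrier has an element outside it.\<close>

lemma (in comm_group) independent_sequence_exists:
  assumes "infinite (carrier G)"
  obtains a :: "nat \<Rightarrow> 'a" where "\<And>n. a n \<in> carrier G"
    "\<And>n I. I \<subseteq> {..<n} \<Longrightarrow> a n \<noteq> finprod G a I"
proof -
  \<comment> \<open>Restricting f to the indices below n makes the condition depend on earlier
    values only, as the dependent choice rule demands.\<close>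
  let ?P = "\<lambda>f n r. r \<in> carrier G \<and> r \<notin> finprod G (restrict f {..<n}) ` Pow {..<n}"
  have "\<exists>a. \<forall>n::nat. ?P a n (a n)"
  proof (rule dependent_wellorder_choice)
    fix r and f g :: "nat \<Rightarrow> 'a" and n :: nat
    assume "\<And>m. m < n \<Longrightarrow> f m = g m"
    then have "restrict f {..<n} = restrict g {..<n}" by (intro restrict_ext) auto
    then show "?P f n r = ?P g n r" by simp
  next
    fix n and f :: "nat \<Rightarrow> 'a"
    have "infinite (carrier G - finprod G (restrict f {..<n}) ` Pow {..<n})"
      using assms by (intro Diff_infinite_finite) auto
    then obtain r where "r \<in> carrier G - finprod G (restrict f {..<n}) ` Pow {..<n}"
      using infinite_imp_nonempty by blast
    then show "\<exists>r. ?P f n r" by (intro exI[of _ r]) simp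
  qed
  then obtain a where a: "\<forall>n::nat. ?P a n (a n)" ..
  then have carr: "a n \<in> carrier G" for n by simp
  have "a n \<noteq> finprod G a I" if I: "I \<subseteq> {..<n}" for n I
  proof -
    have "finprod G (restrict a {..<n}) I = finprod G a I"
      by (intro finprod_cong') (use carr I in auto)
    then have "finprod G a I \<in> finprod G (restrict a {..<n}) ` Pow {..<n}"
      using I by (metis PowI imageI)
    moreover have "a n \<notin> finprod G (restrict a {..<n}) ` Pow {..<n}" using a by simp
    ultimately show ?thesis by metis
  qed
  then show ?thesis by (rule that[OF carr])
qed

text \<open>The independent sequence is the image of the standard basis: x goes to the product of
  the terms over its support, and independence makes this homomorphism injective.\<close>

lemma (in group) direct_sum_Z2_embeds:
  assumes inf: "infinite (carrier G)" and self_inv: "\<And>x. x \<in> carrier G \<Longrightarrow> x \<otimes> x = \<one>"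
  obtains H where "subgroup H G" "G\<lparr>carrier := H\<rparr> \<cong> direct_sum_Z2"
proof -
  interpret comm_group G using self_inv by (rule comm_group_if_self_inverse)
  obtain a :: "nat \<Rightarrow> 'a" where a: "\<And>n. a n \<in> carrier G"
    and indep: "\<And>n I. I \<subseteq> {..<n} \<Longrightarrow> a n \<noteq> finprod G a I"
    using independent_sequence_exists[OF inf] by blast
  have nontriv: "finprod G a I \<noteq> \<one>" if I: "finite I" "I \<noteq> {}" for I
  proof
    assume eq: "finprod G a I = \<one>"
    \<comment> \<open>In a trivial product the term of largest index equals the inverse of the
      remaining product, hence that product itself, against independence.\<close>
    let ?m = "Max I"
    have sub: "I - {?m} \<subseteq> {..<?m}" using I by (auto simp: less_le)
    have "finprod G a (insert ?m (I - {?m})) = a ?m \<otimes> finprod G a (I - {?m})"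
      using I a by (intro finprod_insert) auto
    moreover have "insert ?m (I - {?m}) = I" using I Max_in by blast
    ultimately have "a ?m \<otimes> finprod G a (I - {?m}) = \<one>" using eq by simp
    then have "a ?m = inv (finprod G a (I - {?m}))" using a by (intro inv_equality[symmetric]) auto
    also have "\<dots> = finprod G a (I - {?m})" using a self_inv by (intro inv_equality) auto
    finally show False using indep[OF sub] by simp
  qed
  define h where "h x = finprod G a {n. x n \<noteq> (0::int)}" for x
  have supp: "{n. (x n + y n) mod 2 \<noteq> 0} =
      ({n. x n \<noteq> 0} - {n. y n \<noteq> 0}) \<union> ({n. y n \<noteq> 0} - {n. x n \<noteq> 0})"
    if "x \<in> carrier direct_sum_Z2" "y \<in> carrier direct_sum_Z2" for x y
  proof -
    have "z n \<in> {0, 1}" if "z \<in> carrier direct_sum_Z2" for z n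
    proof -
      have "0 \<le> z n" "z n < 2" using that by (auto simp: carrier_direct_sum_Z2)
      then show ?thesis by auto
    qed
    then have "x n \<in> {0, 1}" "y n \<in> {0, 1}" for n using that by blast+
    then have "(x n + y n) mod 2 \<noteq> 0 \<longleftrightarrow> (x n \<noteq> 0) \<noteq> (y n \<noteq> 0)" for n
      by (metis (no_types, lifting) add_0 add.right_neutral empty_iff insert_iff mod_self
          one_add_one one_mod_two_eq_one zero_neq_one mod_0)
    then show ?thesis by auto
  qed
  have h_hom: "h \<in> hom direct_sum_Z2 G"
  proof (rule homI)
    show "h x \<in> carrier G" for x using a by (simp add: h_def)
    fix x y assume xy: "x \<in> carrier direct_sum_Z2" "y \<in> carrier direct_sum_Z2"
    have "h x \<otimes> h y = finprod G a {n. (x n + y n) mod 2 \<noteq> 0}"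
      unfolding h_def supp[OF xy] using xy a self_inv
      by (intro finprod_mult_sym_diff) (auto simp: carrier_direct_sum_Z2)
    then show "h (x \<otimes>\<^bsub>direct_sum_Z2\<^esub> y) = h x \<otimes> h y"
      by (simp add: h_def mult_direct_sum_Z2)
  qed
  interpret h: group_hom direct_sum_Z2 G h
    by (simp add: group_hom_def group_hom_axioms_def group_direct_sum_Z2 h_hom)
  have inj: "inj_on h (carrier direct_sum_Z2)"
    unfolding h.inj_on_one_iff
  proof (intro allI impI)
    fix x assume x: "x \<in> carrier direct_sum_Z2" "h x = \<one>"
    then have "{n. x n \<noteq> 0} = {}" using nontriv[of "{n. x n \<noteq> 0}"]
      by (auto simp: h_def carrier_direct_sum_Z2)
    then show "x = \<one>\<^bsub>direct_sum_Z2\<^esub>" by (auto simp: one_direct_sum_Z2)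
  qed
  let ?H = "h ` carrier direct_sum_Z2"
  have "h \<in> iso direct_sum_Z2 (G\<lparr>carrier := ?H\<rparr>)"
    using inj by (auto simp: iso_def hom_def bij_betw_def)
  then have "G\<lparr>carrier := ?H\<rparr> \<cong> direct_sum_Z2"
    using group.iso_sym[OF group_direct_sum_Z2] by (auto simp: is_iso_def)
  then show ?thesis using that h.img_is_subgroup by blast
qed

section \<open>Assembling the equivalences\<close>

theorem theorem3p10:
  fixes G :: "('a, 'b) monoid_scheme"
  assumes "group G"
  shows
    "let
       P1 = (\<forall>c. finite_coloring (carrier G) c \<longrightarrow>
               (\<exists>H. subgroup H G \<and> infinite H \<and> almost_monochromatic c H));
       P2 = (\<forall>c. finite_coloring (carrier G) c \<longrightarrow>
               (\<exists>S. subsemigroup S G \<and> infinite S \<and> almost_monochromatic c S));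
       P3 = (\<forall>c. coloring 2 (carrier G) c \<longrightarrow>
               (\<exists>H. subgroup H G \<and> infinite H \<and> almost_monochromatic c H));
       P4 = (\<forall>c. coloring 2 (carrier G) c \<longrightarrow>
               (\<exists>S. subsemigroup S G \<and> infinite S \<and> almost_monochromatic c S));
       P5 = (\<exists>H. subgroup H G \<and> G\<lparr>carrier := H\<rparr> \<cong> direct_sum_Z2)
     in (P1 \<longleftrightarrow> P2) \<and> (P2 \<longleftrightarrow> P3) \<and> (P3 \<longleftrightarrow> P4) \<and> (P4 \<longleftrightarrow> P5)"
proof -
  interpret group G by fact
  let ?P1 = "\<forall>c. finite_coloring (carrier G) c \<longrightarrow>
               (\<exists>H. subgroup H G \<and> infinite H \<and> almost_monochromatic c H)"
  let ?P2 = "\<forall>c. finite_coloring (carrier G) c \<longrightarrow>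
               (\<exists>S. subsemigroup S G \<and> infinite S \<and> almost_monochromatic c S)"
  let ?P3 = "\<forall>c. coloring 2 (carrier G) c \<longrightarrow>
               (\<exists>H. subgroup H G \<and> infinite H \<and> almost_monochromatic c H)"
  let ?P4 = "\<forall>c. coloring 2 (carrier G) c \<longrightarrow>
               (\<exists>S. subsemigroup S G \<and> infinite S \<and> almost_monochromatic c S)"
  let ?P5 = "\<exists>H. subgroup H G \<and> G\<lparr>carrier := H\<rparr> \<cong> direct_sum_Z2"
  have sub: "subsemigroup H G" if "subgroup H G" for H
  proof -
    interpret H: subgroup H G by fact
    have "H \<noteq> {}" using H.one_closed by blast
    then show ?thesis by (auto simp: subsemigroup_def)
  qed
  have two: "finite_coloring (carrier G) c" if "coloring 2 (carrier G) c" for c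
    using that by (auto simp: finite_coloring_def)
  \<comment> \<open>\<open>?P1\<close> implies \<open>?P4\<close> through either \<open>?P2\<close>
    or \<open>?P3\<close> by weakening; \<open>?P4\<close> to \<open>?P5\<close> to
    \<open>?P1\<close> closes both cycles.\<close>
  have "?P1 \<Longrightarrow> ?P2" "?P3 \<Longrightarrow> ?P4" using sub by meson+
  moreover have "?P1 \<Longrightarrow> ?P3" "?P2 \<Longrightarrow> ?P4" using two by meson+
  moreover have ?P5 if P4: ?P4
  proof -
    obtain c where "coloring 2 (carrier G) c"
      and c: "\<And>S. subsemigroup S G \<Longrightarrow> almost_monochromatic c S \<Longrightarrow> finite {x \<in> S. x \<otimes>\<^bsub>G\<^esub> x \<noteq> \<one>\<^bsub>G\<^esub>}"
      using coloring_forcing_involutions by metis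
    then obtain S where S: "subsemigroup S G" "infinite S" "almost_monochromatic c S"
      using P4 by meson
    obtain K where K: "subgroup K G" "infinite K" "\<And>x. x \<in> K \<Longrightarrow> x \<otimes>\<^bsub>G\<^esub> x = \<one>\<^bsub>G\<^esub>"
      using self_inverse_subgroup_in_subsemigroup[OF S(1,2) c[OF S(1,3)]] by metis
    interpret K: group "G\<lparr>carrier := K\<rparr>" using K(1) by (rule subgroup_imp_group)
    obtain H where H: "subgroup H (G\<lparr>carrier := K\<rparr>)"
      "G\<lparr>carrier := K, carrier := H\<rparr> \<cong> direct_sum_Z2"
      using K.direct_sum_Z2_embeds K by auto
    then show ?P5 using incl_subgroup[OF K(1)] by auto
  qed
  moreover have ?P1 if ?P5
  proof (intro allI impI)
    fix c assume c: "finite_coloring (carrier G) c"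
    obtain K h where K: "subgroup K G" and h: "h \<in> iso (G\<lparr>carrier := K\<rparr>) direct_sum_Z2"
      using \<open>?P5\<close> by (auto simp: is_iso_def)
    interpret K: group "G\<lparr>carrier := K\<rparr>" using K(1) by (rule subgroup_imp_group)
    interpret h: group_hom "G\<lparr>carrier := K\<rparr>" direct_sum_Z2 h
      using h by (auto simp: group_hom_def group_hom_axioms_def group_direct_sum_Z2 iso_def K.is_group)
    have bij: "bij_betw h K (carrier direct_sum_Z2)" using h by (simp add: iso_def)
    have infK: "infinite K" using bij_betw_finite[OF bij] infinite_carrier_direct_sum_Z2 by simp
    \<comment> \<open>The law x x = 1 is pulled back from the direct sum along the injective
      \<open>h\<close>.\<close>
    have self_inv: "x \<otimes>\<^bsub>G\<^esub> x = \<one>\<^bsub>G\<^esub>" if x: "x \<in> K" for x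
    proof (rule inj_onD[OF bij_betw_imp_inj_on[OF bij]])
      show "h (x \<otimes>\<^bsub>G\<^esub> x) = h \<one>\<^bsub>G\<^esub>"
        using h.hom_mult[of x x] h.hom_one x direct_sum_Z2_self_inverse by simp
    qed (use subgroup.m_closed[OF K x x] subgroup.one_closed[OF K] in auto)
    have "finite_coloring K c"
      using c subgroup.subset[OF K] by (auto simp: finite_coloring_def coloring_def)
    then obtain H i where H: "subgroup H (G\<lparr>carrier := K\<rparr>)" "infinite H"
      "\<And>x. x \<in> H - {\<one>\<^bsub>G\<^esub>} \<Longrightarrow> c x = i"
      using K.monochromatic_subgroup_exists[of c] infK self_inv by auto
    have "{x \<in> H. c x \<noteq> i} \<subseteq> {\<one>\<^bsub>G\<^esub>}" using H by auto
    then have "almost_monochromatic c H"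
      unfolding almost_monochromatic_def by (meson finite.emptyI finite_insert finite_subset)
    then show "\<exists>H. subgroup H G \<and> infinite H \<and> almost_monochromatic c H"
      using H incl_subgroup[OF K] by blast
  qed
  ultimately show ?thesis unfolding Let_def by argo
qed

end
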